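(* Let $f(t)\in\mathbb{C}[[t]]$ have zero constant term and nonzero coefficient of $t$, let $\mathbf{P}=\{p_n(x)\}_{n\ge0}$ be the Sheffer sequence for $(1,f(t))$, and define $T_1(n,k;\mathbf{P})$ by $x^{[n]}=\sum_{k=0}^{n}T_1(n,k;\mathbf{P})\,p_k(x)$. Then for each $k\ge0$, $$\sum_{n=k}^{\infty}T_1(n,k;\mathbf{P})\frac{t^n}{n!}=\frac{1}{k!}\big(LC_{f(t)}t\big)^{k},\qquad\text{where } LC_{f(t)}t=f\Big(2\log\Big(\frac{t+\sqrt{t^2+4}}{2}\Big)\Big).$$
   Context: Central factorials: $x^{[0]}=1$ and for $n\ge1$, $x^{[n]}=x(x+\tfrac n2-1)(x+\tfrac n2-2)\cdots(x-\tfrac n2+1)$. With $\bar f$ the compositional inverse of $f$, the Sheffer sequence for $(1,f(t))$ is the polynomial sequence $p_n(x)$ ($\deg p_n=n$) with $\sum_{n\ge0}p_n(x)\frac{t^n}{n!}=e^{x\bar f(t)}$. Here $2\log\big(\frac{t+\sqrt{t^2+4}}{2}\big)$ denotes the formal power series (with zero constant term) which is the compositional inverse of $e^{t/2}-e^{-t/2}$; $LC_{f(t)}t$ is called the central logarithm associated to $f(t)$. *)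

theory Defs
  imports Complex_Main "HOL-Computational_Algebra.Computational_Algebra"
begin

unbundle fps_syntax

definition central_factorial :: "nat \<Rightarrow> complex poly" where
  "central_factorial n =
     (if n = 0 then 1
      else [:0, 1:] * (\<Prod>j = 1..n - 1. [:of_nat n / 2 - of_nat j, 1:]))"

text \<open>
  The exponential generating function is compared in \<open>\<complex>[[t]]\<close> for every value of \<open>x\<close>;
  as \<open>\<complex>\<close> is infinite, this is the same as comparing coefficients in \<open>\<complex>[x][[t]]\<close>.
  The series \<open>exp (x g(t))\<close> is \<^term>\<open>fps_exp x oo g\<close>.
\<close>
definition is_sheffer_1 :: "complex fps \<Rightarrow> (nat \<Rightarrow> complex poly) \<Rightarrow> bool" where
  "is_sheffer_1 f p \<longleftrightarrow>
     (\<forall>n. degree (p n) = n) \<and>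
     (\<forall>x. Abs_fps (\<lambda>n. poly (p n) x / fact n) = fps_exp x oo fps_inv f)"

text \<open>
  The coefficients of the central factorials with respect to a basis \<open>p\<close> with
  \<open>deg p\<^sub>k = k\<close>, extended by zero for \<open>k > n\<close>.
\<close>
definition central_T1 :: "(nat \<Rightarrow> complex poly) \<Rightarrow> nat \<Rightarrow> nat \<Rightarrow> complex" where
  "central_T1 p n =
     (THE c. (\<forall>k>n. c k = 0) \<and> central_factorial n = (\<Sum>k\<le>n. smult (c k) (p k)))"

text \<open>
  The square root has constant term \<^term>\<open>csqrt 4 = 2\<close>, so the argument of the logarithm has
  constant term 1; \<^term>\<open>fps_ln 1\<close> is the series of \<open>log (1 + t)\<close>.
\<close>
definition central_log_arg :: "complex fps" where
  "central_log_arg = fps_const (1/2) * (fps_X + fps_radical (\<lambda>_. csqrt) 2 (fps_X\<^sup>2 + 4))"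

definition central_log :: "complex fps" where
  "central_log = fps_const 2 * (fps_ln 1 oo (central_log_arg - 1))"

definition LC :: "complex fps \<Rightarrow> complex fps" where
  "LC f = f oo central_log"


lemma degree_central_factorial: "degree (central_factorial n) = n"
proof (cases "n = 0")
  case False
  have "degree (\<Prod>j = 1..n - 1. [:of_nat n / 2 - of_nat j, 1:] :: complex poly) = n - 1"
    by (subst degree_prod_eq_sum_degree) auto
  moreover have "(\<Prod>j = 1..n - 1. [:of_nat n / 2 - of_nat j, 1:] :: complex poly) \<noteq> 0"
    by auto
  ultimately show ?thesis
    using False by (simp add: central_factorial_def degree_mult_eq)
qed (simp add: central_factorial_def)

lemma ex1_basis_expansion:
  fixes p :: "nat \<Rightarrow> complex poly"
  assumes deg: "\<And>k. degree (p k) = k" and "p 0 \<noteq> 0" and "degree q \<le> n"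
  shows "\<exists>!c. (\<forall>k>n. c k = 0) \<and> q = (\<Sum>k\<le>n. smult (c k) (p k))"
proof -
  have lc: "coeff (p k) k \<noteq> 0" for k
    using deg[of k] \<open>p 0 \<noteq> 0\<close> by (cases k) (metis degree_0 leading_coeff_neq_0 old.nat.distinct(2))+
  have hi: "coeff (p k) m = 0" if "k < m" for k m
    using that deg by (simp add: coeff_eq_0)
  have ex: "\<exists>c. (\<forall>k>n. c k = 0) \<and> q = (\<Sum>k\<le>n. smult (c k) (p k))" if "degree q \<le> n" for n q
    using that
  proof (induction n arbitrary: q)
    case 0
    have "q = smult (coeff q 0 / coeff (p 0) 0) (p 0)"
      using 0 lc[of 0] deg[of 0] by (intro poly_eqI) (metis (no_types, lifting) coeff_eq_0 coeff_smult gr0I le_zero_eq mult_zero_right nonzero_eq_divide_eq)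
    thus ?case by (intro exI[of _ "\<lambda>k. if k = 0 then coeff q 0 / coeff (p 0) 0 else 0"]) simp
  next
    case (Suc n)
    define a where "a = coeff q (Suc n) / coeff (p (Suc n)) (Suc n)"
    have "coeff (q - smult a (p (Suc n))) m = 0" if "m > n" for m
      using that Suc.prems lc[of "Suc n"] hi[of "Suc n" m]
      by (cases "m = Suc n") (auto simp: a_def coeff_eq_0)
    hence "degree (q - smult a (p (Suc n))) \<le> n"
      by (intro degree_le) auto
    from Suc.IH[OF this] obtain c where c: "\<forall>k>n. c k = 0"
      "q - smult a (p (Suc n)) = (\<Sum>k\<le>n. smult (c k) (p k))" by blast
    have "(\<Sum>k\<le>n. smult ((c(Suc n := a)) k) (p k)) = (\<Sum>k\<le>n. smult (c k) (p k))"
      by (intro sum.cong) auto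
    hence "q = (\<Sum>k\<le>Suc n. smult ((c(Suc n := a)) k) (p k))"
      using c(2) by (simp add: algebra_simps)
    thus ?case using c(1) by (intro exI[of _ "c(Suc n := a)"]) auto
  qed
  have zero: "\<forall>k\<le>n. d k = 0" if "(\<Sum>k\<le>n. smult (d k) (p k)) = 0" for d and n :: nat
    using that
  proof (induction n)
    case 0
    thus ?case using \<open>p 0 \<noteq> 0\<close> by simp
  next
    case (Suc n)
    have "coeff (\<Sum>k\<le>Suc n. smult (d k) (p k)) (Suc n) = d (Suc n) * coeff (p (Suc n)) (Suc n)"
      by (simp add: coeff_sum hi)
    hence "d (Suc n) = 0" unfolding Suc.prems using lc[of "Suc n"] by simp
    thus ?case using Suc by (auto simp: le_Suc_eq)
  qed
  show ?thesis
  proof (rule ex_ex1I)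
    show "\<exists>c. (\<forall>k>n. c k = 0) \<and> q = (\<Sum>k\<le>n. smult (c k) (p k))"
      using ex assms(3) by blast
    fix c c'
    assume c: "(\<forall>k>n. c k = 0) \<and> q = (\<Sum>k\<le>n. smult (c k) (p k))"
       and c': "(\<forall>k>n. c' k = 0) \<and> q = (\<Sum>k\<le>n. smult (c' k) (p k))"
    have "(\<Sum>k\<le>n. smult (c k - c' k) (p k)) = 0"
      using c c' by (simp add: smult_diff_left sum_subtractf)
    from zero[OF this] have "\<forall>k\<le>n. c k = c' k" by simp
    with c c' show "c = c'" by (metis ext not_le)
  qed
qed

lemma central_T1_unique:
  assumes "is_sheffer_1 f p"
  shows "\<exists>!c. (\<forall>k>n. c k = 0) \<and> central_factorial n = (\<Sum>k\<le>n. smult (c k) (p k))"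
proof (rule ex1_basis_expansion)
  have "(Abs_fps (\<lambda>n. poly (p n) 0 / fact n)) $ 0 = (fps_exp 0 oo fps_inv f) $ 0"
    using assms by (simp only: is_sheffer_1_def)
  thus "p 0 \<noteq> 0" by auto
qed (use assms in \<open>auto simp: is_sheffer_1_def degree_central_factorial\<close>)

lemma central_T1_expansion:
  assumes "is_sheffer_1 f p"
  shows "k > n \<Longrightarrow> central_T1 p n k = 0"
    and "central_factorial n = (\<Sum>k\<le>n. smult (central_T1 p n k) (p k))"
  using theI'[OF central_T1_unique[OF assms, of n]] by (simp_all add: central_T1_def)

lemma central_log_nth_0: "central_log $ 0 = 0"
  by (simp add: central_log_def)

lemma central_log_eq_fps_inv:
  "central_log = fps_inv (fps_exp (1/2) - fps_exp (-1/2))"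
proof -
  define r :: "complex fps" where "r = fps_radical (\<lambda>_. csqrt) 2 (fps_X\<^sup>2 + 4)"
  define w where "w = central_log_arg"
  define L where "L = fps_ln 1 oo (w - 1)"
  define d :: "complex fps" where "d = fps_exp (1/2) - fps_exp (-1/2)"
  have four: "csqrt 4 = 2"
    using csqrt_of_real_nonneg[of 4] by simp
  have n4: "(4 :: complex fps) $ 0 = 4"
    by (simp add: fps_numeral_nth)
  have r2: "r\<^sup>2 = fps_X\<^sup>2 + 4"
    using power_radical[of "fps_X\<^sup>2 + 4 :: complex fps" "\<lambda>_. csqrt" 1]
    by (simp add: r_def numeral_2_eq_2 n4 flip: numeral_2_eq_2)
  have wr: "w = fps_const (1/2) * (fps_X + r)"
    by (simp add: w_def r_def central_log_arg_def)
  have w0: "w $ 0 = 1"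
    by (simp add: wr r_def four n4)
  have half: "2 * fps_const (1/2) = (1 :: complex fps)"
    by (simp add: numeral_fps_const)
  have w2: "2 * w = fps_X + r"
    by (simp add: wr half flip: mult.assoc)
  have "4 * (w * (w - fps_X)) = (2 * w)\<^sup>2 - 2 * fps_X * (2 * w)"
    by (simp add: algebra_simps power2_eq_square)
  also have "\<dots> = r\<^sup>2 - fps_X\<^sup>2"
    unfolding w2 by (simp add: algebra_simps power2_eq_square)
  also have "\<dots> = 4 * 1" using r2 by simp
  finally have "w * (w - fps_X) = 1" by simp
  hence inv_w: "inverse w = w - fps_X" by (rule fps_inverse_unique)
  have L0: "L $ 0 = 0" by (simp add: L_def)
  have "(fps_exp 1 - 1) oo fps_ln (1::complex) = fps_X"
    by (simp only: fps_ln_fps_exp_inv[of 1] fps_inv_fps_exp_compose(2) one_neq_zero not_False_eq_True)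
  hence "((fps_exp 1 - 1) oo fps_ln (1::complex)) oo (w - 1) = w - 1"
    using w0 by (simp add: fps_X_fps_compose_startby0)
  hence "(fps_exp 1 - 1) oo L = w - 1"
    using w0 by (simp add: L_def fps_compose_assoc)
  hence expL: "fps_exp 1 oo L = w"
    by (simp add: fps_compose_sub_distrib)
  have lin: "fps_exp c oo central_log = fps_exp (2 * c) oo L" for c :: complex
  proof -
    have "fps_exp (2 * c) oo L = (fps_exp c oo (fps_const 2 * fps_X)) oo L"
      by (simp only: fps_exp_compose_linear)
    also have "\<dots> = fps_exp c oo ((fps_const 2 * fps_X) oo L)"
      using L0 by (simp add: fps_compose_assoc del: fps_exp_compose_linear)
    also have "(fps_const 2 * fps_X) oo L = central_log"
      using L0 by (simp add: fps_compose_mult_distrib fps_X_fps_compose_startby0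
          central_log_def L_def w_def)
    finally show ?thesis ..
  qed
  have "fps_exp (-1) oo L = inverse w"
    using L0 expL by (simp add: fps_exp_neg fps_inverse_compose)
  hence dc: "d oo central_log = fps_X"
    using lin[of "1/2"] lin[of "-1/2"] expL inv_w by (simp add: d_def fps_compose_sub_distrib)
  have d0: "d $ 0 = 0" and d1: "d $ 1 \<noteq> 0"
    by (simp_all add: d_def)
  have "central_log = (fps_inv d oo d) oo central_log"
    using d0 d1 by (simp add: fps_inv fps_X_fps_compose_startby0 central_log_nth_0)
  also have "\<dots> = fps_inv d oo (d oo central_log)"
    using d0 by (simp add: fps_compose_assoc central_log_nth_0)
  finally show ?thesis unfolding dc by (simp add: d_def)
qed

end

theory Submission
  imports Defs
begin

text \<open>
  Put \<open>g = central_log\<close>, the compositional inverse of \<open>d = exp (t/2) - exp (-t/2)\<close>.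
  The series \<open>exp (x g)\<close> satisfies the second order equation
  \<open>(1 + t\<^sup>2/4) F'' + (t/4) F' = x\<^sup>2 F\<close>, which on coefficients is the two-step recurrence
  \<open>x\<^bsup>[n+2]\<^esup> = (x\<^sup>2 - n\<^sup>2/4) x\<^bsup>[n]\<^esup>\<close>; so it is the exponential generating function of the
  central factorials. On the other hand \<open>g = fps_inv f \<circ> LC f\<close>, so \<open>exp (x g)\<close> is the
  generating function of \<open>p\<close> composed with \<open>LC f\<close>. Comparing coefficients of \<open>t\<^sup>n\<close> gives the
  expansion of \<open>x\<^bsup>[n]\<^esup>\<close> in the basis \<open>p\<close>.
\<close>

text \<open>Going from \<open>n\<close> to \<open>n + 2\<close> keeps all factors of the old product
  and adds one at each end, x + n/2 and x - n/2, whose product is x^2 - n^2/4. The case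
  \<open>n = 0\<close> is separate because x^[0] = 1 lacks the leading factor x.\<close>

lemma poly_central_factorial_Suc_Suc:
  "poly (central_factorial (Suc (Suc n))) x
     = (x\<^sup>2 - (of_nat n)\<^sup>2 / 4) * poly (central_factorial n) x"
proof (cases n)
  case 0
  then show ?thesis by (simp add: central_factorial_def power2_eq_square)
next
  case (Suc m)
  define h where "h j = of_nat n / 2 - of_nat j + x" for j
  have "(\<Prod>j = 1..Suc n. of_nat (Suc (Suc n)) / 2 - of_nat j + x) = (\<Prod>j = 0..n. h j)"
    unfolding One_nat_def prod.shift_bounds_cl_Suc_ivl by (simp add: h_def field_simps)
  also have "\<dots> = h 0 * (\<Prod>j = 1..m. h j) * h n"
    by (simp add: Suc prod.atLeast_Suc_atMost)
  also have "\<dots> = (x\<^sup>2 - (of_nat n)\<^sup>2 / 4) * (\<Prod>j = 1..m. h j)"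
    by (simp add: h_def field_simps power2_eq_square)
  finally show ?thesis
    using Suc by (simp add: central_factorial_def poly_prod h_def del: of_nat_Suc prod.cl_ivl_Suc)
qed

lemma two_sinh_half_compose_central_log:
  "(fps_exp (1/2) - fps_exp (-1/2)) oo central_log = (fps_X :: complex fps)"
  unfolding central_log_eq_fps_inv by (rule fps_inv_right) simp_all

lemma exp_central_log_ode:
  fixes x :: complex
  defines "F \<equiv> fps_exp x oo central_log"
  shows "(1 + fps_const (1/4) * fps_X\<^sup>2) * fps_deriv (fps_deriv F)
           + fps_const (1/4) * fps_X * fps_deriv F = fps_const (x\<^sup>2) * F"
proof -
  let ?g = central_log
  define u v where "u = fps_exp (1/2) oo ?g" and "v = fps_exp (-1/2) oo ?g"
  \<comment> \<open>This is cosh(g/2). Since u - v = t is 2 sinh(g/2), differentiating gives g' c =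
    1, and cosh^2 - sinh^2 = 1 gives c^2 = 1 + t^2/4.\<close>
  define c where "c = fps_const (1/2) * (u + v)"
  note [simp] = fps_compose_deriv[OF central_log_nth_0] fps_compose_mult_distrib[OF central_log_nth_0]
  have uv: "u - v = fps_X"
    using two_sinh_half_compose_central_log by (simp add: u_def v_def fps_compose_sub_distrib)
  have du: "fps_deriv u = fps_const (1/2) * u * fps_deriv ?g"
    and dv: "fps_deriv v = - fps_const (1/2) * v * fps_deriv ?g"
    and dF: "fps_deriv F = fps_const x * F * fps_deriv ?g"
    by (simp_all add: u_def v_def F_def)
  have gc: "fps_deriv ?g * c = 1"
  proof -
    have "1 = fps_deriv (u - v)" by (simp add: uv)
    then show ?thesis by (simp add: du dv c_def algebra_simps fps_const_neg[symmetric] del: fps_const_neg)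
  qed
  have "u * v = 1"
  proof -
    have "u * v = (fps_exp (1/2) * fps_exp (-1/2)) oo ?g" by (simp add: u_def v_def)
    also have "fps_exp (1/2) * fps_exp (-1/2) = (1 :: complex fps)"
      by (simp flip: fps_exp_add_mult)
    finally show ?thesis by simp
  qed
  moreover have "c\<^sup>2 = fps_const (1/4) * (u + v)\<^sup>2"
    by (simp add: c_def power_mult_distrib fps_const_power power2_eq_square)
  moreover have "(u + v)\<^sup>2 = (u - v)\<^sup>2 + 4 * (u * v)"
    by (simp add: power2_eq_square algebra_simps)
  ultimately have c2: "c\<^sup>2 = 1 + fps_const (1/4) * fps_X\<^sup>2"
    by (simp add: uv algebra_simps numeral_fps_const)
  have dc: "fps_deriv c = fps_const (1/4) * fps_X * fps_deriv ?g"
  proof -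
    have "fps_deriv c = fps_const (1/2) * fps_const (1/2) * (u - v) * fps_deriv ?g"
      by (simp add: c_def du dv algebra_simps fps_const_neg[symmetric] del: fps_const_neg)
    then show ?thesis by (simp add: uv)
  qed
  have Fc: "fps_deriv F * c = fps_const x * F"
    using gc by (simp add: dF mult.assoc)
  \<comment> \<open>Differentiating c F' = x F and multiplying by c once more leaves only c^2 and c
    c', both polynomials in t.\<close>
  have "fps_deriv (fps_deriv F * c) = fps_const x * fps_deriv F"
    by (simp add: Fc)
  then have "fps_deriv (fps_deriv F) * c + fps_deriv F * fps_deriv c = fps_const x * fps_deriv F"
    by (simp add: algebra_simps)
  then have "(fps_deriv (fps_deriv F) * c + fps_deriv F * fps_deriv c) * c = fps_const x * fps_deriv F * c"
    by simp
  then have "fps_deriv (fps_deriv F) * c\<^sup>2 + fps_deriv F * (fps_deriv c * c)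
      = fps_const x * (fps_deriv F * c)"
    by (simp add: algebra_simps power2_eq_square)
  moreover have "fps_deriv c * c = fps_const (1/4) * fps_X"
    by (simp add: dc gc mult.assoc)
  ultimately have "fps_deriv (fps_deriv F) * (1 + fps_const (1/4) * fps_X\<^sup>2)
      + fps_deriv F * (fps_const (1/4) * fps_X) = fps_const x * (fps_const x * F)"
    by (simp only: c2 Fc)
  then show ?thesis
    by (simp only: mult_ac power2_eq_square flip: fps_const_mult)
qed

lemma central_log_nth_1: "central_log $ 1 = 1"
  unfolding central_log_eq_fps_inv by (simp add: fps_inv_def)

lemma central_factorial_egf:
  "Abs_fps (\<lambda>n. poly (central_factorial n) x / fact n) = fps_exp x oo central_log"
proof -
  define F where "F = fps_exp x oo central_log"
  have rec: "fact (Suc (Suc n)) * F $ Suc (Suc n) = (x\<^sup>2 - (of_nat n)\<^sup>2 / 4) * (fact n * F $ n)" for n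
  proof -
    have "((1 + fps_const (1/4) * fps_X\<^sup>2) * fps_deriv (fps_deriv F)
           + fps_const (1/4) * fps_X * fps_deriv F) $ n = x\<^sup>2 * F $ n"
      unfolding F_def exp_central_log_ode by simp
    \<comment> \<open>The terms in t^2 F'' and t F' contribute n(n-1)/4 + n/4 = n^2/4. The cases n =
      0 and n = 1 are split off because the shift by t^2 would reach below index 0.\<close>
    also have "((1 + fps_const (1/4) * fps_X\<^sup>2) * fps_deriv (fps_deriv F)
           + fps_const (1/4) * fps_X * fps_deriv F) $ n
        = of_nat (Suc (Suc n)) * of_nat (Suc n) * F $ Suc (Suc n) + (of_nat n)\<^sup>2 / 4 * F $ n"
      by (cases n; cases "n - 1")
        (simp_all add: distrib_right mult.assoc fps_X_power_mult_nth field_simps power2_eq_square)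
    finally have "of_nat (Suc (Suc n)) * of_nat (Suc n) * F $ Suc (Suc n)
        = (x\<^sup>2 - (of_nat n)\<^sup>2 / 4) * F $ n"
      by (simp add: algebra_simps)
    then show ?thesis by (simp add: fact_Suc mult.commute mult.left_commute del: of_nat_Suc)
  qed
  have "poly (central_factorial n) x = fact n * F $ n" for n
  proof (induction n rule: nat_induct2)
    case (step n)
    then show ?case using rec[of n] by (simp add: poly_central_factorial_Suc_Suc)
  next
    case 1
    \<comment> \<open>The recurrence preserves parity, so the odd indices need their own start:
      x^[1] = x matches the linear coefficient 1 of g.\<close>
    show ?case
      using central_log_nth_1 central_log_nth_0
      by (simp add: F_def central_factorial_def fps_compose_nth)
  qed (simp add: F_def central_factorial_def)
  then show ?thesis by (simp add: fps_eq_iff F_def)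
qed

theorem theorem5p2:
  fixes f :: "complex fps" and p :: "nat \<Rightarrow> complex poly" and k :: nat
  assumes "fps_nth f 0 = 0"
    and "fps_nth f 1 \<noteq> 0"
    and "is_sheffer_1 f p"
  shows "Abs_fps (\<lambda>n. if n < k then 0 else central_T1 p n k / fact n)
           = fps_const (1 / fact k) * LC f ^ k"
proof -
  have LC0: "LC f $ 0 = 0" using assms(1) by (simp add: LC_def)
  have LC_nth: "LC f ^ j $ n = 0" if "n < j" for n j
    using LC0 that by (simp add: startsby_zero_power_prefix)
  have inv0: "fps_inv f $ 0 = 0" by (simp add: fps_inv_def)
  have log: "fps_inv f oo LC f = central_log"
    using assms(1,2)
    by (simp add: LC_def fps_compose_assoc central_log_nth_0 fps_inv fps_X_fps_compose_startby0)
  \<comment> \<open>Read off from n! times the coefficient of t^n in the sum of p_j(x) (LC f)^j /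
    j!. As \<open>LC f\<close> has no constant term, \<open>c n j\<close> vanishes for j > n, which
    is the normalisation that makes the expansion unique.\<close>
  define c where "c n j = fact n / fact j * (LC f ^ j $ n)" for n j
  have "central_factorial n = (\<Sum>j\<le>n. smult (c n j) (p j))" for n
  proof (rule poly_ext)
    fix x
    have egf: "Abs_fps (\<lambda>n. poly (p n) x / fact n) = fps_exp x oo fps_inv f"
      using assms(3) by (simp add: is_sheffer_1_def)
    have "Abs_fps (\<lambda>n. poly (central_factorial n) x / fact n)
        = Abs_fps (\<lambda>n. poly (p n) x / fact n) oo LC f"
      by (simp add: central_factorial_egf egf log LC0 inv0 flip: fps_compose_assoc)
    then have "Abs_fps (\<lambda>n. poly (central_factorial n) x / fact n) $ n
        = (Abs_fps (\<lambda>n. poly (p n) x / fact n) oo LC f) $ n" by simp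
    then show "poly (central_factorial n) x = poly (\<Sum>j\<le>n. smult (c n j) (p j)) x"
      by (simp add: fps_compose_nth poly_sum c_def sum_distrib_left atLeast0AtMost field_simps)
  qed
  then have "central_T1 p n = c n" for n
    using central_T1_unique[OF assms(3), of n] LC_nth
    unfolding central_T1_def by (intro the1_equality) (auto simp: c_def)
  then show ?thesis
    by (simp add: fps_eq_iff c_def LC_nth)
qed

end
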